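(* Let $G$ be an abelian group, $A\subseteq G$ finite nonempty and $\kappa\in(0,1]$. If there exists a finite set $B\subseteq G$ such that $\|1_A\ast 1_B\|_3\ge\kappa^{1/3}|A|^{2/3}|B|^{2/3}$, then there exists $A'\subseteq A$ with $|A'|\ge c_1(\log(2/\kappa))^{-c_2}\kappa^{2/3}|A|$ such that \[|A'-A'|\le C_1(\log(2/\kappa))^{C_2}\kappa^{-2}|A'|,\] where $c_1,c_2,C_1,C_2>0$ are absolute constants.
   Context: $1_A\ast 1_B(x)=\sum_y 1_A(x-y)1_B(y)$ and $\|f\|_3=(\sum_x|f(x)|^3)^{1/3}$. $A'-A'=\{a-b:a,b\in A'\}$.
   Formalization: The finite set B is additionally required to be nonempty: with B empty the hypothesis reads 0 ≥ 0, and the claim then fails, e.g. for κ = 1 and A a large Sidon set. *)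

theory Defs
  imports "HOL-Analysis.Analysis" "HOL-Algebra.Group"
begin

text \<open>The abelian group is written multiplicatively, so \<open>x - y\<close> becomes
  \<open>x \<otimes> inv y\<close>. The group may be infinite, hence \<open>infsum\<close>
  (\<open>sum\<close> over an infinite set would be \<open>0\<close>); for indicators of finite
  sets all these sums have finite support.\<close>

definition conv :: "'a monoid \<Rightarrow> ('a \<Rightarrow> real) \<Rightarrow> ('a \<Rightarrow> real) \<Rightarrow> 'a \<Rightarrow> real" where
  "conv G f g x = (\<Sum>\<^sub>\<infinity>y\<in>carrier G. f (x \<otimes>\<^bsub>G\<^esub> inv\<^bsub>G\<^esub> y) * g y)"

definition l3_norm :: "'a monoid \<Rightarrow> ('a \<Rightarrow> real) \<Rightarrow> real" where
  "l3_norm G f = (\<Sum>\<^sub>\<infinity>x\<in>carrier G. \<bar>f x\<bar> ^ 3) powr (1 / 3)"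

definition difference_set :: "'a monoid \<Rightarrow> 'a set \<Rightarrow> 'a set" where
  "difference_set G A = {a \<otimes>\<^bsub>G\<^esub> inv\<^bsub>G\<^esub> b | a b. a \<in> A \<and> b \<in> A}"

definition structured_subset_bound ::
    "'a monoid \<Rightarrow> real \<Rightarrow> real \<Rightarrow> real \<Rightarrow> real \<Rightarrow> bool" where
  "structured_subset_bound G c1 c2 C1 C2 \<longleftrightarrow>
     (\<forall>A \<kappa>. A \<subseteq> carrier G \<and> finite A \<and> A \<noteq> {} \<and> 0 < \<kappa> \<and> \<kappa> \<le> 1 \<and>
        (\<exists>B. B \<subseteq> carrier G \<and> finite B \<and> B \<noteq> {} \<and>
           l3_norm G (conv G (indicator A) (indicator B))
             \<ge> \<kappa> powr (1/3) * real (card A) powr (2/3) * real (card B) powr (2/3))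
      \<longrightarrow> (\<exists>A'. A' \<subseteq> A \<and>
             real (card A') \<ge> c1 * ln (2 / \<kappa>) powr (- c2) * \<kappa> powr (2/3) * real (card A) \<and>
             real (card (difference_set G A'))
               \<le> C1 * ln (2 / \<kappa>) powr C2 * \<kappa> powr (-2) * real (card A')))"

text \<open>HOL cannot quantify over types inside a formula, so in a polymorphic statement
  \<open>\<exists>c. \<forall>G :: 'a monoid. \<dots>\<close> the constants could depend on the type \<open>'a\<close>.
  To make them absolute, they are fixed once by a choice that does not mention \<open>'a\<close>:
  any four positive reals that work for all abelian groups carried by sets of natural numbers.
  That these numbers are positive and work for groups over an arbitrary type is
  not built in here but has to be proved; nothing is lost by the choice, since
  the subgroup generated by two finite sets is countable.\<close>

definition absolute_constants :: "real \<times> real \<times> real \<times> real" where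
  "absolute_constants = (SOME (c1, c2, C1, C2).
     0 < c1 \<and> 0 < c2 \<and> 0 < C1 \<and> 0 < C2 \<and>
     (\<forall>G :: nat monoid. comm_group G \<longrightarrow> structured_subset_bound G c1 c2 C1 C2))"

end

theory Submission
  imports Defs "HOL-Algebra.Weak_Morphisms" "HOL-Algebra.Generated_Groups"
begin

text \<open>
  A dyadic decomposition of \<open>1\<^sub>A * 1\<^sub>B\<close> produces a level set \<open>S\<close> such that the number \<open>T\<close> of
  pairs \<open>(a, b)\<close> with \<open>a + b \<in> S\<close> satisfies \<open>T\<^sup>3 \<ge> k (|A| |B| |S|)\<^sup>2\<close>, where
  \<open>k = \<kappa> / (48 log (2 / \<kappa>))\<close>. This inequality is invariant under replacing \<open>(B, S)\<close> by
  \<open>(-S, -B)\<close>, so one may assume \<open>|B| \<le> |S|\<close>.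

  Dependent random choice selects \<open>b \<in> B\<close> such that \<open>A \<inter> (S - b)\<close> has \<open>n \<ge> T / (\<surd>2 |B|)\<close> elements
  and most pairs \<open>a, a'\<close> in it have at least \<open>\<delta> = T\<^sup>2 / (16 |B| |A|\<^sup>2)\<close> common neighbours, that is
  \<open>\<delta>\<close> representations of \<open>a - a'\<close> as a difference of elements of \<open>S\<close>. For the at least
  \<open>n / 2\<close> elements \<open>A'\<close> with few bad partners, each element of \<open>A' - A'\<close> then has
  \<open>(n / 2) \<delta>\<^sup>2\<close> representations as \<open>s\<^sub>1 - s\<^sub>2 + s\<^sub>3 - s\<^sub>4\<close>, so \<open>|A' - A'| (n / 2) \<delta>\<^sup>2 \<le> |S|\<^sup>4\<close>, which gives
  \<open>|A' - A'| \<le> 2048 k\<^sup>-\<^sup>2 |A'|\<close>. Since \<open>T \<le> |B| |S|\<close> and \<open>|B| \<le> |S|\<close>, also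
  \<open>T\<^sup>2 \<ge> k |A|\<^sup>2 |B|\<^sup>2\<close>, so that \<open>|A'| \<ge> \<surd>k |A| / 3\<close>, more than the required \<open>\<kappa>\<^sup>2\<^sup>/\<^sup>3\<close>.

  As the constants are chosen for groups on the natural numbers, the case of an arbitrary group is
  transferred through the countable subgroup generated by \<open>A \<union> B\<close>.
\<close>

subsection \<open>Dyadic decomposition and dependent random choice\<close>

text \<open>If \<open>t < u\<close>, then \<open>u\<^sup>2 * t\<close> alone dominates the cube.
  Otherwise the largest scale \<open>2 ^ i * u\<close> not exceeding \<open>t\<close> is within a
  factor 2 of \<open>t\<close>, so its cube is within a factor 8. The induction peels off the top
  scale.\<close>

lemma cube_le_dyadic_sum:
  fixes t u :: real
  assumes "0 \<le> t" "0 \<le> u" "t < 2 ^ N * u"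
  shows "t ^ 3 \<le> u\<^sup>2 * t + 8 * (\<Sum>i<N. if 2 ^ i * u \<le> t then (2 ^ i * u) ^ 3 else 0)"
  using assms(3)
proof (induction N)
  case 0
  then have "t\<^sup>2 \<le> u\<^sup>2" using assms by (intro power_mono) auto
  then have "t\<^sup>2 * t \<le> u\<^sup>2 * t" using assms by (intro mult_right_mono) auto
  then show ?case by (simp add: power3_eq_cube power2_eq_square)
next
  case (Suc N)
  show ?case
  proof (cases "2 ^ N * u \<le> t")
    case True
    have "t ^ 3 \<le> (2 * (2 ^ N * u)) ^ 3" using Suc.prems assms by (intro power_mono) auto
    also have "\<dots> = 8 * (2 ^ N * u) ^ 3" by (simp add: power_mult_distrib)
    also have "\<dots> \<le> u\<^sup>2 * t + 8 * (\<Sum>i<Suc N. if 2 ^ i * u \<le> t then (2 ^ i * u) ^ 3 else 0)"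
    proof -
      have "0 \<le> (\<Sum>i<N. if 2 ^ i * u \<le> t then (2 ^ i * u) ^ 3 else 0)"
        using assms by (intro sum_nonneg) auto
      moreover have "0 \<le> u\<^sup>2 * t" using assms by simp
      ultimately show ?thesis using True by simp
    qed
    finally show ?thesis .
  qed (use Suc in simp)
qed

text \<open>Summing the pointwise bound over \<open>X\<close> and exchanging the sums turns the
  dyadic indicators into sizes of level sets. Values below \<open>u\<close> are charged to the first
  moment.\<close>

lemma sum_cubes_le_level_sets:
  fixes f :: "'b \<Rightarrow> real" and u :: real
  assumes "finite X" "\<And>x. x \<in> X \<Longrightarrow> 0 \<le> f x" "0 \<le> u" "\<And>x. x \<in> X \<Longrightarrow> f x < 2 ^ N * u"
  shows "(\<Sum>x\<in>X. f x ^ 3)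
    \<le> u\<^sup>2 * (\<Sum>x\<in>X. f x) + 8 * (\<Sum>i<N. (2 ^ i * u) ^ 3 * card {x \<in> X. 2 ^ i * u \<le> f x})"
proof -
  have "(\<Sum>x\<in>X. f x ^ 3)
    \<le> (\<Sum>x\<in>X. u\<^sup>2 * f x + 8 * (\<Sum>i<N. if 2 ^ i * u \<le> f x then (2 ^ i * u) ^ 3 else 0))"
    using assms by (intro sum_mono cube_le_dyadic_sum) auto
  also have "\<dots> = u\<^sup>2 * (\<Sum>x\<in>X. f x)
      + 8 * (\<Sum>i<N. \<Sum>x\<in>X. if 2 ^ i * u \<le> f x then (2 ^ i * u) ^ 3 else 0)"
    by (simp add: sum.distrib sum_distrib_left sum.swap[of _ X])
  also have "(\<Sum>i<N. \<Sum>x\<in>X. if 2 ^ i * u \<le> f x then (2 ^ i * u) ^ 3 else 0)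
      = (\<Sum>i<N. (2 ^ i * u) ^ 3 * card {x \<in> X. 2 ^ i * u \<le> f x})"
    using assms(1) by (intro sum.cong) (auto simp: sum.If_cases Int_def)
  finally show ?thesis .
qed

text \<open>The random choice is an average over \<open>b\<close> in \<open>B\<close>.
  Cauchy-Schwarz makes the neighbourhoods \<open>N b\<close> large in mean square, while a pair with
  fewer than \<delta> common neighbours lies in few of the sets \<open>N b \<times> N b\<close>.
  Some \<open>b\<close> therefore has a large neighbourhood of size \<open>n\<close> with few bad
  pairs, and discarding the vertices with many bad partners leaves \<open>A'\<close>.\<close>

lemma dependent_random_choice:
  fixes E :: "'b \<Rightarrow> 'c \<Rightarrow> bool" and T \<delta> :: real
  assumes fin: "finite A" "finite B"
    and T: "T = (\<Sum>b\<in>B. real (card {a \<in> A. E a b}))" "0 < T"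
    and \<delta>: "\<delta> = T\<^sup>2 / (16 * card B * (card A)\<^sup>2)"
  obtains A' and n :: real where
    "A' \<subseteq> A" "0 < n" "T\<^sup>2 \<le> 2 * n\<^sup>2 * (card B)\<^sup>2" "n / 2 \<le> card A'"
    "\<And>a a''. a \<in> A' \<Longrightarrow> a'' \<in> A' \<Longrightarrow>
       n / 2 \<le> card {a' \<in> A. \<delta> \<le> card {b \<in> B. E a b \<and> E a' b} \<and> \<delta> \<le> card {b \<in> B. E a'' b \<and> E a' b}}"
proof -
  define N where "N b = {a \<in> A. E a b}" for b
  define r where "r a a' = card {b \<in> B. E a b \<and> E a' b}" for a a'
  define bad where "bad b = {p \<in> N b \<times> N b. r (fst p) (snd p) < \<delta>}" for b
  have finN [simp]: "finite (N b)" for b unfolding N_def using fin by auto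
  have finbad [simp]: "finite (bad b)" for b unfolding bad_def by auto
  have "B \<noteq> {}" using T by auto
  then have cB: "0 < real (card B)" using fin by auto
  have "A \<noteq> {}" using T by auto
  then have cA: "0 < real (card A)" using fin by auto
  have \<delta>pos: "0 < \<delta>" unfolding \<delta> using T cA cB by simp
  have "T\<^sup>2 \<le> (\<Sum>b\<in>B. (real (card (N b)))\<^sup>2) * card B"
    using Cauchy_Schwarz_ineq_sum[of "\<lambda>b. real (card (N b))" "\<lambda>_. 1" B] by (simp add: T N_def)
  then have sq: "T\<^sup>2 / card B \<le> (\<Sum>b\<in>B. (real (card (N b)))\<^sup>2)"
    using cB by (simp add: divide_simps)
  \<comment> \<open>Double counting: a pair \<open>(a, a')\<close> with fewer than \<delta> common
    neighbours is in \<open>bad b\<close> for exactly \<open>r a a'\<close> choices of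
    \<open>b\<close>.\<close>
  have "(\<Sum>b\<in>B. card (bad b)) = (\<Sum>b\<in>B. \<Sum>p\<in>{p\<in>A\<times>A. r (fst p) (snd p) < \<delta>}. if E (fst p) b \<and> E (snd p) b then 1 else 0)"
  proof (rule sum.cong[OF refl])
    fix b assume "b \<in> B"
    have "bad b = {p\<in>A\<times>A. r (fst p) (snd p) < \<delta>} \<inter> {p. E (fst p) b \<and> E (snd p) b}"
      unfolding bad_def N_def by auto
    then show "card (bad b) = (\<Sum>p\<in>{p\<in>A\<times>A. r (fst p) (snd p) < \<delta>}. if E (fst p) b \<and> E (snd p) b then 1 else 0)"
      using fin by (simp add: sum.If_cases)
  qed
  also have "\<dots> = (\<Sum>p\<in>{p\<in>A\<times>A. r (fst p) (snd p) < \<delta>}. r (fst p) (snd p))"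
    unfolding r_def using fin by (subst sum.swap) (auto simp: sum.If_cases Int_def intro!: sum.cong)
  finally have "real (\<Sum>b\<in>B. card (bad b)) = (\<Sum>p\<in>{p\<in>A\<times>A. r (fst p) (snd p) < \<delta>}. real (r (fst p) (snd p)))"
    by simp
  also have "\<dots> \<le> (\<Sum>p\<in>{p\<in>A\<times>A. r (fst p) (snd p) < \<delta>}. \<delta>)"
    by (intro sum_mono) auto
  also have "\<dots> \<le> (\<Sum>p\<in>A\<times>A. \<delta>)"
    using fin \<delta>pos by (intro sum_mono2) auto
  also have "\<dots> = \<delta> * (card A)\<^sup>2"
    by (simp add: card_cartesian_product power2_eq_square)
  also have "\<dots> = T\<^sup>2 / card B / 16" unfolding \<delta> using cA by simp
  finally have badsum: "(\<Sum>b\<in>B. real (card (bad b))) \<le> T\<^sup>2 / card B / 16" by simp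
  \<comment> \<open>The weight 8 makes the bad pairs cost at most half of the second moment
    \<open>T\<^sup>2 / card B\<close>. The other half, averaged over \<open>B\<close>, is the bound
    claimed here.\<close>
  have "\<exists>b\<in>B. T\<^sup>2 / (2 * (card B)\<^sup>2) \<le> (real (card (N b)))\<^sup>2 - 8 * card (bad b)"
  proof (rule ccontr)
    assume "\<not> ?thesis"
    then have "(\<Sum>b\<in>B. (real (card (N b)))\<^sup>2 - 8 * card (bad b)) < (\<Sum>b\<in>B. T\<^sup>2 / (2 * (card B)\<^sup>2))"
      using fin \<open>B \<noteq> {}\<close> by (intro sum_strict_mono) auto
    also have "\<dots> = T\<^sup>2 / card B / 2" using cB by (simp add: power2_eq_square)
    finally have "(\<Sum>b\<in>B. (real (card (N b)))\<^sup>2) - 8 * (\<Sum>b\<in>B. real (card (bad b))) < T\<^sup>2 / card B / 2"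
      by (simp add: sum_subtractf sum_distrib_left)
    then show False using sq badsum by simp
  qed
  then obtain b where b: "b \<in> B" and
    b1: "T\<^sup>2 / (2 * (card B)\<^sup>2) \<le> (real (card (N b)))\<^sup>2 - 8 * card (bad b)" by blast
  define n where "n = real (card (N b))"
  have posT: "0 < T\<^sup>2 / (2 * (card B)\<^sup>2)" using T cB by simp
  have n2: "T\<^sup>2 \<le> 2 * n\<^sup>2 * (card B)\<^sup>2"
  proof -
    have "T\<^sup>2 / (2 * (card B)\<^sup>2) \<le> n\<^sup>2" using b1 by (simp add: n_def)
    then show ?thesis using cB by (simp add: divide_simps mult_ac)
  qed
  have npos: "0 < n" using posT b1 by (cases "n = 0") (auto simp: n_def)
  have badb: "8 * real (card (bad b)) \<le> n\<^sup>2" using b1 posT by (simp add: n_def)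
  define Bd where "Bd a = {a' \<in> N b. r a a' < \<delta>}" for a
  \<comment> \<open>Since there are at most \<open>n\<^sup>2 / 8\<close> bad pairs, Markov's
    inequality at threshold \<open>n / 4\<close> discards at most \<open>n / 2\<close> vertices. Two
    surviving vertices together exclude at most \<open>n / 2\<close> of the \<open>n\<close>
    elements of \<open>N b\<close>, so at least \<open>n / 2\<close> good partners are common to
    both.\<close>
  define A' where "A' = {a \<in> N b. card (Bd a) \<le> n / 4}"
  have "bad b = Sigma (N b) Bd" unfolding bad_def Bd_def by auto
  then have "real (card (bad b)) = (\<Sum>a\<in>N b. real (card (Bd a)))"
    by (simp add: Bd_def)
  also have "\<dots> \<ge> (\<Sum>a\<in>N b - A'. real (card (Bd a)))"
    by (intro sum_mono2) auto
  also have "(\<Sum>a\<in>N b - A'. real (card (Bd a))) \<ge> (\<Sum>a\<in>N b - A'. n / 4)"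
    by (intro sum_mono) (auto simp: A'_def)
  finally have "real (card (N b - A')) * (n / 4) \<le> real (card (bad b))" by simp
  then have "real (card (N b - A')) * (2 * n) \<le> n * n" using badb by (simp add: power2_eq_square)
  then have "real (card (N b - A')) \<le> n / 2" using npos by simp
  moreover have "real (card (N b - A')) = n - card A'"
    unfolding n_def by (subst card_Diff_subset) (auto simp: A'_def of_nat_diff card_mono intro: finite_subset[OF _ finN])
  ultimately have cA': "n / 2 \<le> card A'" by simp
  show ?thesis
  proof
    show "A' \<subseteq> A" unfolding A'_def N_def by auto
    fix a a'' assume aa: "a \<in> A'" "a'' \<in> A'"
    let ?C = "{a' \<in> A. \<delta> \<le> card {b \<in> B. E a b \<and> E a' b} \<and> \<delta> \<le> card {b \<in> B. E a'' b \<and> E a' b}}"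
    have "N b \<subseteq> ?C \<union> Bd a \<union> Bd a''" unfolding N_def Bd_def r_def by auto
    then have "card (N b) \<le> card (?C \<union> Bd a \<union> Bd a'')"
      using fin by (intro card_mono) (auto simp: Bd_def)
    also have "\<dots> \<le> card ?C + card (Bd a) + card (Bd a'')"
      by (meson card_Un_le add_le_mono order.trans order.refl)
    finally have "n \<le> real (card ?C) + card (Bd a) + card (Bd a'')" unfolding n_def by linarith
    then show "n / 2 \<le> card ?C" using aa unfolding A'_def by auto
  qed (use n2 npos cA' in auto)
qed

subsection \<open>Incidences in an abelian group\<close>

text \<open>For \<open>S = {x}\<close> this is the value at \<open>x\<close> of the convolution of
  the indicators of \<open>A\<close> and \<open>B\<close>. A count of pairs stays finite in an
  infinite group and is easy to transport along injective homomorphisms.\<close>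

definition incidences :: "('a, 'b) monoid_scheme \<Rightarrow> 'a set \<Rightarrow> 'a set \<Rightarrow> 'a set \<Rightarrow> nat" where
  "incidences G A B S = card {(a, b). a \<in> A \<and> b \<in> B \<and> a \<otimes>\<^bsub>G\<^esub> b \<in> S}"

lemma incidences_eq_sum:
  assumes "finite A" "finite B"
  shows "incidences G A B S = (\<Sum>b\<in>B. card {a \<in> A. a \<otimes>\<^bsub>G\<^esub> b \<in> S})"
proof -
  have "incidences G A B S = card (SIGMA b:B. {a \<in> A. a \<otimes>\<^bsub>G\<^esub> b \<in> S})"
    unfolding incidences_def
    by (rule bij_betw_same_card[of "\<lambda>(a, b). (b, a)"]) (auto simp: bij_betw_def inj_on_def)
  then show ?thesis using assms by simp
qed

context
  fixes G :: "'a monoid" (structure)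
  assumes comm_group: "comm_group G"
begin

interpretation comm_group G by (fact comm_group)

text \<open>A path \<open>a, b, a', b', a''\<close> in the incidence graph writes
  \<open>a - a''\<close> as \<open>(a + b) - (a' + b) + (a' + b') - (a'' + b')\<close>, with all
  four terms in \<open>S\<close>. There are at least \<open>m * \<delta>\<^sup>2\<close> such paths
  for each difference, while \<open>S\<close> has only \<open>card S ^ 4\<close> quadruples in
  total.\<close>

lemma card_difference_set_le:
  fixes m \<delta> :: real
  assumes carr: "A \<subseteq> carrier G" "B \<subseteq> carrier G" "S \<subseteq> carrier G" and "finite S" "finite A" "finite B"
    and "A' \<subseteq> A" and nonneg: "0 \<le> m" "0 \<le> \<delta>"
    and common: "\<And>a a''. a \<in> A' \<Longrightarrow> a'' \<in> A' \<Longrightarrow>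
       m \<le> card {a' \<in> A. \<delta> \<le> card {b \<in> B. a \<otimes> b \<in> S \<and> a' \<otimes> b \<in> S} \<and>
                        \<delta> \<le> card {b \<in> B. a'' \<otimes> b \<in> S \<and> a' \<otimes> b \<in> S}}"
  shows "card (difference_set G A') * m * \<delta>\<^sup>2 \<le> real (card S) ^ 4"
proof -
  define P where "P d = {(s1, s2, s3, s4). s1 \<in> S \<and> s2 \<in> S \<and> s3 \<in> S \<and> s4 \<in> S \<and>
      d = (s1 \<otimes> inv s2) \<otimes> (s3 \<otimes> inv s4)}" for d
  have PS: "P d \<subseteq> S \<times> S \<times> S \<times> S" for d unfolding P_def by auto
  have finP: "finite (P d)" for d using PS \<open>finite S\<close> by (meson finite_SigmaI finite_subset)
  have fin: "finite (difference_set G A')"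
  proof -
    have "difference_set G A' = (\<lambda>(a, b). a \<otimes> inv b) ` (A' \<times> A')"
      unfolding difference_set_def by auto
    then show ?thesis using \<open>finite A\<close> \<open>A' \<subseteq> A\<close> by (auto intro: finite_subset)
  qed
  have lower: "m * \<delta>\<^sup>2 \<le> card (P d)" if d: "d \<in> difference_set G A'" for d
  proof -
    obtain a a'' where a: "a \<in> A'" "a'' \<in> A'" "d = a \<otimes> inv a''"
      using d unfolding difference_set_def by auto
    have ac: "a \<in> carrier G" "a'' \<in> carrier G" using a \<open>A' \<subseteq> A\<close> carr by auto
    define Q where "Q x a' = {b \<in> B. x \<otimes> b \<in> S \<and> a' \<otimes> b \<in> S}" for x a'
    define M where "M = {a' \<in> A. \<delta> \<le> card (Q a a') \<and> \<delta> \<le> card (Q a'' a')}"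
    have finQ: "finite (Q x a')" for x a' unfolding Q_def using \<open>finite B\<close> by auto
    \<comment> \<open>The endpoints \<open>a\<close> and \<open>a''\<close> are fixed, so the first
      and last coordinates recover \<open>b\<close> and \<open>b'\<close> by cancellation, and the
      second then recovers \<open>a'\<close>. Distinct paths thus give distinct quadruples.\<close>
    define \<phi> where "\<phi> = (\<lambda>(a', b, b'). (a \<otimes> b, a' \<otimes> b, a' \<otimes> b', a'' \<otimes> b'))"
    have inj: "inj_on \<phi> (SIGMA a':M. Q a a' \<times> Q a'' a')"
    proof (rule inj_onI)
      fix p q assume "p \<in> (SIGMA a':M. Q a a' \<times> Q a'' a')" "q \<in> (SIGMA a':M. Q a a' \<times> Q a'' a')"
        and eq: "\<phi> p = \<phi> q"
      then obtain a1 b1 c1 a2 b2 c2 where pq: "p = (a1, b1, c1)" "q = (a2, b2, c2)"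
        and h: "a1 \<in> M" "b1 \<in> Q a a1" "c1 \<in> Q a'' a1" "a2 \<in> M" "b2 \<in> Q a a2" "c2 \<in> Q a'' a2"
        by auto
      have c: "a1 \<in> carrier G" "a2 \<in> carrier G" "b1 \<in> carrier G" "b2 \<in> carrier G"
        "c1 \<in> carrier G" "c2 \<in> carrier G"
        using h carr unfolding M_def Q_def by auto
      have e: "a \<otimes> b1 = a \<otimes> b2" "a1 \<otimes> b1 = a2 \<otimes> b2" "a'' \<otimes> c1 = a'' \<otimes> c2"
        using eq unfolding \<phi>_def pq by auto
      have "b1 = b2" "c1 = c2" using e c ac by (metis Units_eq Units_l_cancel)+
      moreover have "a1 = a2" using e c \<open>b1 = b2\<close> by (metis right_cancel)
      ultimately show "p = q" by (simp add: pq)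
    qed
    have sub: "\<phi> ` (SIGMA a':M. Q a a' \<times> Q a'' a') \<subseteq> P d"
    proof (rule image_subsetI)
      fix p assume "p \<in> (SIGMA a':M. Q a a' \<times> Q a'' a')"
      then obtain a' b b' where p: "p = (a', b, b')" and h: "a' \<in> M" "b \<in> Q a a'" "b' \<in> Q a'' a'" by auto
      have c: "a' \<in> carrier G" "b \<in> carrier G" "b' \<in> carrier G"
        using h carr unfolding M_def Q_def by auto
      have cancel: "(x \<otimes> y) \<otimes> inv (z \<otimes> y) = x \<otimes> inv z"
        if "x \<in> carrier G" "y \<in> carrier G" "z \<in> carrier G" for x y z
        using that by (simp add: inv_mult_group m_assoc[symmetric]) (simp add: m_assoc)
      have "(a \<otimes> inv a') \<otimes> (a' \<otimes> inv a'') = a \<otimes> inv a''"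
        using c ac by (simp add: m_assoc) (simp add: m_assoc[symmetric])
      then have "d = ((a \<otimes> b) \<otimes> inv (a' \<otimes> b)) \<otimes> ((a' \<otimes> b') \<otimes> inv (a'' \<otimes> b'))"
        using c ac a by (simp add: cancel)
      then show "\<phi> p \<in> P d" using h unfolding p \<phi>_def P_def Q_def by simp
    qed
    have "m * \<delta>\<^sup>2 \<le> card M * \<delta>\<^sup>2"
      using common[OF a(1,2)] nonneg unfolding M_def Q_def by (intro mult_right_mono) auto
    also have "\<dots> = (\<Sum>a'\<in>M. \<delta> * \<delta>)" by (simp add: power2_eq_square)
    also have "\<dots> \<le> (\<Sum>a'\<in>M. real (card (Q a a')) * real (card (Q a'' a')))"
      using nonneg by (intro sum_mono mult_mono) (auto simp: M_def)
    also have "\<dots> = card (SIGMA a':M. Q a a' \<times> Q a'' a')"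
      using finQ \<open>finite A\<close> by (simp add: M_def card_SigmaI card_cartesian_product)
    also have "\<dots> \<le> card (P d)"
      using card_inj_on_le[OF inj sub finP] by simp
    finally show ?thesis .
  qed
  have "card (difference_set G A') * m * \<delta>\<^sup>2 = (\<Sum>d\<in>difference_set G A'. m * \<delta>\<^sup>2)" by simp
  also have "\<dots> \<le> (\<Sum>d\<in>difference_set G A'. real (card (P d)))"
    by (intro sum_mono lower)
  \<comment> \<open>A quadruple determines the difference it represents, so the sets
    \<open>P d\<close> are pairwise disjoint.\<close>
  also have "\<dots> = real (card (\<Union>d\<in>difference_set G A'. P d))"
    by (subst card_UN_disjoint) (use fin finP in \<open>auto simp: P_def\<close>)
  also have "\<dots> \<le> real (card (S \<times> S \<times> S \<times> S))"
    using PS \<open>finite S\<close> by (intro of_nat_mono card_mono) auto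
  also have "\<dots> = real (card S) ^ 4"
    by (simp add: card_cartesian_product eval_nat_numeral)
  finally show ?thesis .
qed

lemma incidences_le_card_mult:
  assumes "A \<subseteq> carrier G" "B \<subseteq> carrier G" "finite B" "finite S"
  shows "incidences G A B S \<le> card B * card S"
proof -
  have "incidences G A B S \<le> card (B \<times> S)"
    unfolding incidences_def
  proof (rule card_inj_on_le[where f = "\<lambda>(a, b). (b, a \<otimes> b)"])
    show "inj_on (\<lambda>(a, b). (b, a \<otimes> b)) {(a, b). a \<in> A \<and> b \<in> B \<and> a \<otimes> b \<in> S}"
      using assms by (auto simp: inj_on_def subset_iff)
  qed (use assms in auto)
  then show ?thesis by (simp add: card_cartesian_product)
qed

text \<open>The equation \<open>a + b = s\<close> reads \<open>a + (-s) = -b\<close>, so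
  \<open>(a, b)\<close> is sent to \<open>(a, -s)\<close>. This symmetry exchanges the sizes of
  \<open>B\<close> and \<open>S\<close> and leaves \<open>A\<close> alone.\<close>

lemma incidences_inv_swap_le:
  assumes carr: "A \<subseteq> carrier G" "B \<subseteq> carrier G" "S \<subseteq> carrier G" and fin: "finite A" "finite S"
  shows "incidences G A B S \<le> incidences G A (m_inv G ` S) (m_inv G ` B)"
  unfolding incidences_def
proof (rule card_inj_on_le[where f = "\<lambda>(a, b). (a, inv (a \<otimes> b))"])
  have inv': "a \<otimes> inv (a \<otimes> b) = inv b" if "a \<in> carrier G" "b \<in> carrier G" for a b
  proof -
    have "a \<otimes> inv (a \<otimes> b) = a \<otimes> (inv a \<otimes> inv b)" using that by (simp only: inv_mult)
    also have "\<dots> = (a \<otimes> inv a) \<otimes> inv b" using that by (simp only: m_assoc inv_closed)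
    finally show ?thesis using that by simp
  qed
  show "inj_on (\<lambda>(a, b). (a, inv (a \<otimes> b))) {(a, b). a \<in> A \<and> b \<in> B \<and> a \<otimes> b \<in> S}"
  proof (rule inj_onI)
    fix p q assume "p \<in> {(a, b). a \<in> A \<and> b \<in> B \<and> a \<otimes> b \<in> S}" "q \<in> {(a, b). a \<in> A \<and> b \<in> B \<and> a \<otimes> b \<in> S}"
      and eq: "(\<lambda>(a, b). (a, inv (a \<otimes> b))) p = (\<lambda>(a, b). (a, inv (a \<otimes> b))) q"
    then obtain a b b' where pq: "p = (a, b)" "q = (a, b')" and h: "a \<in> A" "b \<in> B" "b' \<in> B"
      by auto
    have c: "a \<in> carrier G" "b \<in> carrier G" "b' \<in> carrier G" using h carr by auto
    have "inv (a \<otimes> b) = inv (a \<otimes> b')" using eq unfolding pq by (simp only: case_prod_conv prod.inject)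
    then have "a \<otimes> inv (a \<otimes> b) = a \<otimes> inv (a \<otimes> b')" by (rule arg_cong)
    then have "inv b = inv b'" unfolding inv'[OF c(1,2)] inv'[OF c(1,3)] .
    then have "b = b'" by (rule inj_onD[OF inv_inj _ c(2,3)])
    then show "p = q" using pq by (simp only:)
  qed
  show "(\<lambda>(a, b). (a, inv (a \<otimes> b))) ` {(a, b). a \<in> A \<and> b \<in> B \<and> a \<otimes> b \<in> S}
    \<subseteq> {(a, b). a \<in> A \<and> b \<in> m_inv G ` S \<and> a \<otimes> b \<in> m_inv G ` B}"
  proof (rule image_subsetI)
    fix p assume "p \<in> {(a, b). a \<in> A \<and> b \<in> B \<and> a \<otimes> b \<in> S}"
    then obtain a b where p: "p = (a, b)" "a \<in> A" "b \<in> B" "a \<otimes> b \<in> S" by auto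
    then have "a \<otimes> inv (a \<otimes> b) = inv b" using inv' carr by blast
    then show "(\<lambda>(a, b). (a, inv (a \<otimes> b))) p \<in> {(a, b). a \<in> A \<and> b \<in> m_inv G ` S \<and> a \<otimes> b \<in> m_inv G ` B}"
      using p by simp
  qed
  show "finite {(a, b). a \<in> A \<and> b \<in> m_inv G ` S \<and> a \<otimes> b \<in> m_inv G ` B}"
    using fin by (auto intro: finite_subset[of _ "A \<times> (m_inv G ` S)"])
qed

text \<open>Dependent random choice on the graph \<open>a \<otimes> b \<in> S\<close> supplies the
  hypotheses of \<open>card_difference_set_le\<close> with \<open>m = n / 2\<close>. The assumption
  on the sizes of \<open>B\<close> and \<open>S\<close> serves the lower bound on
  \<open>card A'\<close>.\<close>

lemma structured_subset_of_incidences_aux: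
  fixes k :: real
  assumes carr: "A \<subseteq> carrier G" "B \<subseteq> carrier G" "S \<subseteq> carrier G"
    and fin: "finite A" "finite B" "finite S" and "0 < incidences G A B S" and "0 < k"
    and T: "k * (real (card A) * card B * card S)\<^sup>2 \<le> real (incidences G A B S) ^ 3"
    and BS: "card B \<le> card S"
  obtains A' where "A' \<subseteq> A" "sqrt k / 3 * card A \<le> card A'"
    "k\<^sup>2 * card (difference_set G A') \<le> 2048 * card A'"
proof -
  define T where "T = real (incidences G A B S)"
  define a b s where "a = real (card A)" and "b = real (card B)" and "s = real (card S)"
  have "0 < T" using assms by (simp add: T_def)
  have "T = (\<Sum>b\<in>B. real (card {a \<in> A. a \<otimes> b \<in> S}))"
    unfolding T_def by (simp add: incidences_eq_sum[OF fin(1,2)])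
  from dependent_random_choice[OF fin(1,2) this \<open>0 < T\<close> refl] obtain A' n
    where A': "A' \<subseteq> A" and n: "0 < n" "T\<^sup>2 \<le> 2 * n\<^sup>2 * b\<^sup>2" "n / 2 \<le> card A'"
    and common: "\<And>x x''. x \<in> A' \<Longrightarrow> x'' \<in> A' \<Longrightarrow>
       n / 2 \<le> card {x' \<in> A. T\<^sup>2 / (16 * b * a\<^sup>2) \<le> card {y \<in> B. x \<otimes> y \<in> S \<and> x' \<otimes> y \<in> S} \<and>
                        T\<^sup>2 / (16 * b * a\<^sup>2) \<le> card {y \<in> B. x'' \<otimes> y \<in> S \<and> x' \<otimes> y \<in> S}}"
    unfolding a_def b_def by (auto simp: of_nat_power)
  define D where "D = real (card (difference_set G A'))"
  have D: "D * (n / 2) * (T\<^sup>2 / (16 * b * a\<^sup>2))\<^sup>2 \<le> s ^ 4"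
    unfolding D_def s_def
    by (rule card_difference_set_le[OF carr fin(3,1,2) A' _ _ common]) (use n in \<open>auto simp: b_def\<close>)
  have "B \<noteq> {}" "A \<noteq> {}" "S \<noteq> {}" using \<open>0 < incidences G A B S\<close> by (auto simp: incidences_def)
  then have pos: "0 < a" "0 < b" "0 < s" using fin by (auto simp: a_def b_def s_def card_gt_0_iff)
  have "D * n * T ^ 4 \<le> 512 * b\<^sup>2 * a ^ 4 * s ^ 4"
    using D pos by (simp add: divide_simps power_mult_distrib mult_ac flip: power_mult)
  \<comment> \<open>The factor \<open>T\<^sup>2\<close>, bounded by
    \<open>2 * n\<^sup>2 * b\<^sup>2\<close>, completes \<open>T ^ 6\<close>, the square of the
    quantity in the hypothesis. It also balances the right side into \<open>(a * b * s) ^ 4\<close>,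
    which cancels and leaves only \<open>k\<close> and \<open>n\<close>.\<close>
  then have "(D * n * T ^ 4) * T\<^sup>2 \<le> (512 * b\<^sup>2 * a ^ 4 * s ^ 4) * (2 * n\<^sup>2 * b\<^sup>2)"
    using n pos by (intro mult_mono[where a = "D * n * T ^ 4" and c = "T\<^sup>2"]) auto
  then have "n * (D * T ^ 6) \<le> n * (1024 * n * (a * b * s) ^ 4)"
    by (simp add: algebra_simps power_mult_distrib eval_nat_numeral)
  then have 1: "D * T ^ 6 \<le> 1024 * n * (a * b * s) ^ 4" using n by simp
  have T3: "k * (a * b * s)\<^sup>2 \<le> T ^ 3" using T by (simp add: a_def b_def s_def T_def)
  then have "(k * (a * b * s)\<^sup>2)\<^sup>2 \<le> (T ^ 3)\<^sup>2"
    using \<open>0 < k\<close> by (intro power_mono) auto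
  then have "k\<^sup>2 * (a * b * s) ^ 4 \<le> T ^ 6"
    by (simp add: power_mult_distrib flip: power_mult)
  then have "D * (k\<^sup>2 * (a * b * s) ^ 4) \<le> D * T ^ 6"
    by (intro mult_left_mono) (auto simp: D_def)
  with 1 have "(k\<^sup>2 * D) * (a * b * s) ^ 4 \<le> (1024 * n) * (a * b * s) ^ 4"
    by (simp add: mult_ac)
  then have "k\<^sup>2 * D \<le> 1024 * n" using pos by simp
  then have final2: "k\<^sup>2 * card (difference_set G A') \<le> 2048 * card A'"
    using n(3) by (simp add: D_def)
  \<comment> \<open>Trading one factor \<open>T\<close> for \<open>b * s\<close> lowers the cubic
    hypothesis to \<open>k * a\<^sup>2 * b * s \<le> T\<^sup>2\<close>. Replacing \<open>s\<close>
    by the smaller \<open>b\<close> makes this comparable with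
    \<open>T\<^sup>2 \<le> 2 * n\<^sup>2 * b\<^sup>2\<close>.\<close>
  have "T \<le> b * s"
    using incidences_le_card_mult[OF carr(1,2) fin(2,3)] unfolding T_def b_def s_def
    by (metis of_nat_le_iff of_nat_mult)
  then have "T\<^sup>2 * T \<le> T\<^sup>2 * (b * s)" by (intro mult_left_mono) auto
  with T3 have "(k * a\<^sup>2 * b * s) * (b * s) \<le> T\<^sup>2 * (b * s)"
    by (simp add: power2_eq_square power3_eq_cube mult_ac)
  then have "k * a\<^sup>2 * b * s \<le> T\<^sup>2" using pos by simp
  moreover have "k * a\<^sup>2 * b * b \<le> k * a\<^sup>2 * b * s"
    using BS \<open>0 < k\<close> pos by (intro mult_left_mono) (auto simp: b_def s_def)
  ultimately have "(k * a\<^sup>2) * b\<^sup>2 \<le> (2 * n\<^sup>2) * b\<^sup>2"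
    using n(2) by (simp add: power2_eq_square mult_ac)
  then have "k * a\<^sup>2 \<le> 2 * n\<^sup>2" using pos by simp
  also have "\<dots> \<le> 2 * (2 * real (card A'))\<^sup>2" using n by (intro mult_left_mono power_mono) auto
  \<comment> \<open>The factor 8 is rounded up to 9, whence the constant 1/3 in the
    conclusion.\<close>
  also have "\<dots> \<le> (3 * real (card A'))\<^sup>2" by (simp add: power_mult_distrib)
  finally have "(sqrt k * a)\<^sup>2 \<le> (3 * real (card A'))\<^sup>2"
    using \<open>0 < k\<close> by (simp add: power_mult_distrib)
  then have "sqrt k * a \<le> 3 * real (card A')" by (rule power2_le_imp_le) simp
  then have "sqrt k / 3 * card A \<le> card A'" by (simp add: a_def)
  with that A' final2 show thesis by blast
qed

text \<open>The hypothesis is symmetric in the sizes of \<open>B\<close> and \<open>S\<close>, and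
  passing to inverses does not lower the number of incidences. The case
  \<open>card S < card B\<close> thus reduces to the previous lemma with the same
  \<open>A\<close>.\<close>

lemma structured_subset_of_incidences:
  fixes k :: real
  assumes carr: "A \<subseteq> carrier G" "B \<subseteq> carrier G" "S \<subseteq> carrier G"
    and fin: "finite A" "finite B" "finite S" and T0: "0 < incidences G A B S" and "0 < k"
    and T: "k * (real (card A) * card B * card S)\<^sup>2 \<le> real (incidences G A B S) ^ 3"
  obtains A' where "A' \<subseteq> A" "sqrt k / 3 * card A \<le> card A'"
    "k\<^sup>2 * card (difference_set G A') \<le> 2048 * card A'"
proof (cases "card B \<le> card S")
  case True
  then show thesis using structured_subset_of_incidences_aux[OF assms] that by blast
next
  case False
  let ?B = "m_inv G ` S" and ?S = "m_inv G ` B"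
  have card: "card ?B = card S" "card ?S = card B"
    using carr inj_on_subset[OF inv_inj] by (auto intro!: card_image)
  have swap: "incidences G A B S \<le> incidences G A ?B ?S"
    by (rule incidences_inv_swap_le[OF carr fin(1,3)])
  have "k * (real (card A) * card ?B * card ?S)\<^sup>2 \<le> real (incidences G A B S) ^ 3"
    using T unfolding card by (simp add: mult_ac)
  also have "\<dots> \<le> real (incidences G A ?B ?S) ^ 3" using swap by (intro power_mono) auto
  finally have T': "k * (real (card A) * card ?B * card ?S)\<^sup>2 \<le> real (incidences G A ?B ?S) ^ 3" .
  have carr': "?B \<subseteq> carrier G" "?S \<subseteq> carrier G" using carr by auto
  have fin': "finite ?B" "finite ?S" using fin by auto
  have pos: "0 < incidences G A ?B ?S" using T0 swap by linarith
  have le: "card ?B \<le> card ?S" using False unfolding card by simp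
  obtain A' where "A' \<subseteq> A" "sqrt k / 3 * card A \<le> card A'"
    "k\<^sup>2 * card (difference_set G A') \<le> 2048 * card A'"
    by (rule structured_subset_of_incidences_aux[OF carr(1) carr' fin(1) fin' pos \<open>0 < k\<close> T' le])
  then show thesis by (rule that)
qed

subsection \<open>The \<open>L\<^sup>3\<close> norm of a convolution\<close>

text \<open>The summand is 1 on the finite set of \<open>y\<close> in \<open>B\<close> with
  \<open>x - y\<close> in \<open>A\<close> and 0 elsewhere; \<open>y\<close> corresponds to the pair
  \<open>(x - y, y)\<close>.\<close>

lemma conv_indicator:
  assumes "A \<subseteq> carrier G" "B \<subseteq> carrier G" "finite B" "x \<in> carrier G"
  shows "conv G (indicator A) (indicator B) x = incidences G A B {x}"
proof -
  have "conv G (indicator A) (indicator B) x = (\<Sum>\<^sub>\<infinity>y\<in>{y \<in> B. x \<otimes> inv y \<in> A}. 1 :: real)"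
    unfolding conv_def using assms by (intro infsum_cong_neutral) (auto simp: indicator_def)
  also have "\<dots> = card {y \<in> B. x \<otimes> inv y \<in> A}" using assms by simp
  also have "card {y \<in> B. x \<otimes> inv y \<in> A} = incidences G A B {x}"
    unfolding incidences_def
  proof (rule bij_betw_same_card[of "\<lambda>y. (x \<otimes> inv y, y)"], rule bij_betw_byWitness[where f' = snd])
    have eq: "(x \<otimes> inv y) \<otimes> y = x" if "y \<in> carrier G" for y
      using assms that by (simp add: m_assoc)
    have eq': "(a \<otimes> b) \<otimes> inv b = a" if "a \<in> carrier G" "b \<in> carrier G" for a b
      using that by (simp add: m_assoc)
    show "(\<lambda>y. (x \<otimes> inv y, y)) ` {y \<in> B. x \<otimes> inv y \<in> A} \<subseteq> {(a, b). a \<in> A \<and> b \<in> B \<and> a \<otimes> b \<in> {x}}"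
      using assms eq by auto
    show "\<forall>p\<in>{(a, b). a \<in> A \<and> b \<in> B \<and> a \<otimes> b \<in> {x}}. (x \<otimes> inv snd p, snd p) = p"
      using assms eq' by auto
    show "snd ` {(a, b). a \<in> A \<and> b \<in> B \<and> a \<otimes> b \<in> {x}} \<subseteq> {y \<in> B. x \<otimes> inv y \<in> A}"
      using assms by (auto simp: eq'[OF subsetD[OF assms(1)] subsetD[OF assms(2)]])
  qed auto
  finally show ?thesis .
qed

lemma incidences_eq_0: "x \<notin> A <#> B \<Longrightarrow> incidences G A B {x} = 0"
proof -
  assume "x \<notin> A <#> B"
  then have "{(a, b). a \<in> A \<and> b \<in> B \<and> a \<otimes> b \<in> {x}} = {}" unfolding set_mult_def by auto
  then show ?thesis unfolding incidences_def by (metis card.empty)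
qed

text \<open>Cubing removes the fractional powers, and the convolution is supported on the finite
  product set \<open>A <#> B\<close>. All later arguments, including the transfer between groups,
  use this finite form.\<close>

lemma l3_norm_conv_ge_iff:
  assumes "A \<subseteq> carrier G" "B \<subseteq> carrier G" "finite A" "finite B" "0 < \<kappa>"
  shows "\<kappa> powr (1/3) * real (card A) powr (2/3) * real (card B) powr (2/3)
      \<le> l3_norm G (conv G (indicator A) (indicator B))
    \<longleftrightarrow> \<kappa> * (real (card A) * card B)\<^sup>2 \<le> (\<Sum>x\<in>(A <#> B). real (incidences G A B {x}) ^ 3)"
proof -
  have sub: "A <#> B \<subseteq> carrier G" using assms unfolding set_mult_def by auto
  have fin: "finite (A <#> B)" using assms unfolding set_mult_def by auto
  have "(\<Sum>\<^sub>\<infinity>x\<in>carrier G. \<bar>conv G (indicator A) (indicator B) x\<bar> ^ 3)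
      = (\<Sum>\<^sub>\<infinity>x\<in>(A <#> B). real (incidences G A B {x}) ^ 3)"
    using sub incidences_eq_0[of _ A B]
    by (intro infsum_cong_neutral) (auto simp: conv_indicator[OF assms(1,2,4)])
  then have l3: "l3_norm G (conv G (indicator A) (indicator B))
      = (\<Sum>x\<in>(A <#> B). real (incidences G A B {x}) ^ 3) powr (1/3)"
    unfolding l3_norm_def using fin by simp
  have sq: "real n powr (2/3) = (real n ^ 2) powr (1/3)" for n
    by (cases "n = 0") (simp_all add: powr_powr flip: powr_numeral)
  have "\<kappa> powr (1/3) * real (card A) powr (2/3) * real (card B) powr (2/3)
      = (\<kappa> * (real (card A) * card B)\<^sup>2) powr (1/3)"
    unfolding sq using assms(5) by (simp add: powr_mult power_mult_distrib mult.assoc)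
  moreover have "x powr (1/3) \<le> y powr (1/3) \<longleftrightarrow> x \<le> y" if "0 \<le> x" "0 \<le> y" for x y :: real
    using that powr_less_mono2[of "1/3" y x] powr_mono2[of "1/3" x y] by force
  ultimately show ?thesis unfolding l3 using assms(5) by (simp add: sum_nonneg)
qed

section \<open>Popular level sets and the bound with explicit constants\<close>

lemma sum_incidences:
  assumes "finite A" "finite B" "finite S"
  shows "(\<Sum>x\<in>S. incidences G A B {x}) = incidences G A B S"
proof -
  have "(\<Sum>x\<in>S. incidences G A B {x}) = card (\<Union>x\<in>S. {(a, b). a \<in> A \<and> b \<in> B \<and> a \<otimes> b \<in> {x}})"
    unfolding incidences_def
  proof (rule card_UN_disjoint[symmetric])
    show "\<forall>x\<in>S. finite {(a, b). a \<in> A \<and> b \<in> B \<and> a \<otimes> b \<in> {x}}"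
      using assms by (auto intro: finite_subset[of _ "A \<times> B"])
  qed (use assms in auto)
  also have "(\<Union>x\<in>S. {(a, b). a \<in> A \<and> b \<in> B \<and> a \<otimes> b \<in> {x}}) = {(a, b). a \<in> A \<and> b \<in> B \<and> a \<otimes> b \<in> S}"
    by auto
  finally show ?thesis by (simp add: incidences_def)
qed

lemma incidences_singleton_le:
  assumes "A \<subseteq> carrier G" "B \<subseteq> carrier G" "finite A" "finite B"
  shows "incidences G A B {x} \<le> card A" "incidences G A B {x} \<le> card B"
proof -
  show "incidences G A B {x} \<le> card B"
    using incidences_le_card_mult[OF assms(1,2,4), of "{x}"] by simp
  show "incidences G A B {x} \<le> card A"
    unfolding incidences_def
  proof (rule card_inj_on_le[where f = fst])
    show "inj_on fst {(a, b). a \<in> A \<and> b \<in> B \<and> a \<otimes> b \<in> {x}}"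
      using assms by (auto intro!: inj_onI) (metis Units_eq Units_l_cancel subsetD)
  qed (use assms in auto)
qed

text \<open>Dyadic pigeonholing: about \<open>log (2 / \<kappa>)\<close> scales carry half of the
  sum of cubes, so one level set \<open>S\<close> at some height \<open>v\<close> has large
  \<open>v ^ 3 * card S\<close>. Since each point of \<open>S\<close> accounts for at least
  \<open>v\<close> incidences, \<open>v * card S\<close> bounds the incidences from below.\<close>

lemma popular_incidences:
  fixes \<kappa> :: real
  assumes carr: "A \<subseteq> carrier G" "B \<subseteq> carrier G" and fin: "finite A" "finite B"
    and ne: "A \<noteq> {}" "B \<noteq> {}" and \<kappa>: "0 < \<kappa>" "\<kappa> \<le> 1"
    and L3: "\<kappa> * (real (card A) * card B)\<^sup>2 \<le> (\<Sum>x\<in>(A <#> B). real (incidences G A B {x}) ^ 3)"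
  obtains S where "S \<subseteq> carrier G" "finite S" "0 < incidences G A B S"
    "\<kappa> / (48 * ln (2 / \<kappa>)) * (real (card A) * card B * card S)\<^sup>2 \<le> real (incidences G A B S) ^ 3"
proof -
  define f where "f x = real (incidences G A B {x})" for x
  define X where "X = A <#> B"
  define a b where "a = real (card A)" and "b = real (card B)"
  define L where "L = ln (2 / \<kappa>)"
  \<comment> \<open>With this cutoff the values below \<open>u\<close> contribute at most
    \<open>u\<^sup>2 * (a * b)\<close>, exactly half of the assumed lower bound.\<close>
  define u where "u = sqrt (\<kappa> * a * b / 2)"
  \<comment> \<open>The convolution is at most both \<open>a\<close> and \<open>b\<close>, so its
    square is at most \<open>a * b = (2 / \<kappa>) * u\<^sup>2\<close>. The successor of the floor
    gives the strict inequality \<open>2 / \<kappa> < 4 ^ N\<close>, hence every value lies below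
    \<open>2 ^ N * u\<close>.\<close>
  define N where "N = Suc (nat \<lfloor>L / ln 4\<rfloor>)"
  have pos: "0 < a" "0 < b" using fin ne by (auto simp: a_def b_def card_gt_0_iff)
  have u: "0 < u" "u\<^sup>2 = \<kappa> * a * b / 2" using pos \<kappa> by (auto simp: u_def)
  have Xc: "X \<subseteq> carrier G" using carr unfolding X_def set_mult_def by auto
  have finX: "finite X" using fin unfolding X_def set_mult_def by simp
  have ln4: "ln 4 = 2 * ln (2::real)" using ln_realpow[of 2 2] by simp
  have "ln 2 \<le> L" unfolding L_def using \<kappa> by (simp add: field_simps)
  then have L: "2/3 \<le> L" using ln2_ge_two_thirds by linarith
  have "0 < N" by (simp add: N_def)
  \<comment> \<open>Because \<open>L\<close> is at least 2/3, the extra 1 is absorbed into a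
    multiple of \<open>L\<close>. This 3, the 8 of the dyadic bound and the 2 from the discarded
    half multiply to 48.\<close>
  have N_le: "N \<le> 3 * L"
  proof -
    have "real N \<le> L / ln 4 + 1" unfolding N_def using L ln4 ln2_ge_two_thirds by simp
    also have "L / ln 4 \<le> L / 1" using L ln4 ln2_ge_two_thirds by (intro divide_left_mono) auto
    finally show ?thesis using L by simp
  qed
  have N_gt: "2 / \<kappa> < 4 ^ N"
  proof -
    have "L / ln 4 < N" unfolding N_def by linarith
    then have "L < N * ln 4" using ln4 ln2_ge_two_thirds by (simp add: divide_simps)
    also have "\<dots> = ln (4 ^ N)" by (simp add: ln_realpow)
    finally show ?thesis unfolding L_def using \<kappa> by simp
  qed
  have f_lt: "f x < 2 ^ N * u" for x
  proof (rule power2_less_imp_less)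
    have "f x * f x \<le> a * b"
      using incidences_singleton_le[OF carr fin, of x] unfolding f_def a_def b_def
      by (intro mult_mono) auto
    also have "a * b = (2 / \<kappa>) * u\<^sup>2" using \<kappa> by (simp add: u)
    also have "\<dots> < 4 ^ N * u\<^sup>2" using N_gt u(1) by (intro mult_strict_right_mono) auto
    also have "\<dots> = (2 ^ N * u)\<^sup>2"
      by (simp add: power_mult_distrib power2_eq_square flip: power_mult_distrib[of 2 2])
    finally show "(f x)\<^sup>2 < (2 ^ N * u)\<^sup>2" by (simp add: power2_eq_square)
  qed (use u in simp)
  have "incidences G A B X = card (A \<times> B)"
    unfolding incidences_def by (rule arg_cong[of _ _ card]) (auto simp: X_def set_mult_def)
  then have sumf: "(\<Sum>x\<in>X. f x) = a * b"
    using sum_incidences[OF fin finX] unfolding f_def a_def b_def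
    by (metis card_cartesian_product of_nat_mult of_nat_sum)
  define S where "S i = {x \<in> X. 2 ^ i * u \<le> f x}" for i
  have "\<kappa> * (a * b)\<^sup>2 \<le> u\<^sup>2 * (a * b) + 8 * (\<Sum>i<N. (2 ^ i * u) ^ 3 * card (S i))"
  proof -
    have "\<kappa> * (a * b)\<^sup>2 \<le> (\<Sum>x\<in>X. f x ^ 3)"
      using L3 by (simp add: f_def X_def a_def b_def)
    also have "\<dots> \<le> u\<^sup>2 * (\<Sum>x\<in>X. f x) + 8 * (\<Sum>i<N. (2 ^ i * u) ^ 3 * card {x \<in> X. 2 ^ i * u \<le> f x})"
      using u(1) f_lt by (intro sum_cubes_le_level_sets[OF finX]) (auto simp: f_def)
    finally show ?thesis by (simp only: sumf S_def)
  qed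
  then have total: "\<kappa> * (a * b)\<^sup>2 / 16 \<le> (\<Sum>i<N. (2 ^ i * u) ^ 3 * card (S i))"
  proof -
    have "u\<^sup>2 * (a * b) = \<kappa> * (a * b)\<^sup>2 / 2" unfolding u(2) by (simp add: power2_eq_square)
    then show ?thesis using \<open>\<kappa> * (a * b)\<^sup>2 \<le> _\<close> by linarith
  qed
  have "\<exists>i<N. \<kappa> * (a * b)\<^sup>2 / 16 / N \<le> (2 ^ i * u) ^ 3 * card (S i)"
  proof (rule ccontr)
    assume "\<not> ?thesis"
    then have "(\<Sum>i<N. (2 ^ i * u) ^ 3 * card (S i)) < (\<Sum>i<N. \<kappa> * (a * b)\<^sup>2 / 16 / N)"
      by (intro sum_strict_mono) (use \<open>0 < N\<close> in \<open>auto simp: not_le\<close>)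
    also have "\<dots> = \<kappa> * (a * b)\<^sup>2 / 16" using \<open>0 < N\<close> by simp
    finally show False using total by linarith
  qed
  then obtain i where i: "\<kappa> * (a * b)\<^sup>2 / 16 / N \<le> (2 ^ i * u) ^ 3 * card (S i)" by blast
  define v where "v = 2 ^ i * u"
  have "\<kappa> / (48 * L) * (a * b)\<^sup>2 \<le> \<kappa> * (a * b)\<^sup>2 / 16 / N"
  proof -
    have "\<kappa> * (a * b)\<^sup>2 / 16 / (3 * L) \<le> \<kappa> * (a * b)\<^sup>2 / 16 / N"
      using N_le \<kappa> L \<open>0 < N\<close> by (intro divide_left_mono) auto
    then show ?thesis by simp
  qed
  with i have v3: "\<kappa> / (48 * L) * (a * b)\<^sup>2 \<le> v ^ 3 * card (S i)" by (simp add: v_def)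
  have Sc: "S i \<subseteq> carrier G" and Sf: "finite (S i)" using Xc finX by (auto simp: S_def)
  have "real (card (S i)) * v = (\<Sum>x\<in>S i. v)" by simp
  also have "\<dots> \<le> (\<Sum>x\<in>S i. f x)" by (intro sum_mono) (auto simp: S_def v_def)
  also have "\<dots> = incidences G A B (S i)"
    unfolding f_def by (simp flip: sum_incidences[OF fin Sf])
  finally have T: "real (card (S i)) * v \<le> incidences G A B (S i)" .
  have "0 < \<kappa> / (48 * L) * (a * b)\<^sup>2" using \<kappa> L pos by simp
  with v3 have "card (S i) \<noteq> 0" by (intro notI) simp
  then have "0 < real (card (S i)) * v" using u by (simp add: v_def)
  with T have "0 < incidences G A B (S i)" by linarith
  moreover have "\<kappa> / (48 * L) * (a * b * card (S i))\<^sup>2 \<le> real (incidences G A B (S i)) ^ 3"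
  proof -
    \<comment> \<open>The factor \<open>(card S)\<^sup>2\<close> turns \<open>v ^ 3 * card S\<close>
      into the cube of \<open>v * card S\<close>, which the incidences dominate.\<close>
    have "\<kappa> / (48 * L) * (a * b)\<^sup>2 * (real (card (S i)))\<^sup>2 \<le> v ^ 3 * card (S i) * (real (card (S i)))\<^sup>2"
      using v3 by (intro mult_right_mono) auto
    also have "\<dots> = (real (card (S i)) * v) ^ 3"
      by (simp add: power2_eq_square power3_eq_cube mult_ac)
    also have "\<dots> \<le> real (incidences G A B (S i)) ^ 3"
      using T u by (intro power_mono) (auto simp: v_def)
    finally show ?thesis by (simp add: power_mult_distrib mult_ac)
  qed
  ultimately show thesis using that[OF Sc Sf] unfolding a_def b_def L_def by blast
qed

text \<open>Here \<open>k = \<kappa> / (48 * L)\<close> with \<open>L = ln (2 / \<kappa>)\<close>.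
  Rounding \<open>sqrt 48\<close> up to 7 turns \<open>sqrt k / 3\<close> into the constant 1/21 and
  the exponent 1/2 of the logarithm, and \<open>\<kappa> \<le> 1\<close> weakens
  \<open>sqrt \<kappa>\<close> to the power 2/3. The other two constants come from
  \<open>2048 / k\<^sup>2\<close>.\<close>

lemma structured_subset_bound_explicit:
  "structured_subset_bound G (1/21) (1/2) (2048 * 48\<^sup>2) 2"
  unfolding structured_subset_bound_def
proof (intro allI impI, elim conjE exE)
  fix A :: "'a set" and \<kappa> :: real and B
  assume A: "A \<subseteq> carrier G" "finite A" "A \<noteq> {}" and \<kappa>: "0 < \<kappa>" "\<kappa> \<le> 1"
    and B: "B \<subseteq> carrier G" "finite B" "B \<noteq> {}"
    and L3: "\<kappa> powr (1/3) * real (card A) powr (2/3) * real (card B) powr (2/3)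
           \<le> l3_norm G (conv G (indicator A) (indicator B))"
  define L where "L = ln (2 / \<kappa>)"
  have L: "0 < L" unfolding L_def using \<kappa> by simp
  define k where "k = \<kappa> / (48 * L)"
  have k: "0 < k" using \<kappa> L by (simp add: k_def)
  obtain S where S: "S \<subseteq> carrier G" "finite S" "0 < incidences G A B S"
    "k * (real (card A) * card B * card S)\<^sup>2 \<le> real (incidences G A B S) ^ 3"
    using popular_incidences[OF A(1) B(1) A(2) B(2) A(3) B(3) \<kappa>] L3
    unfolding l3_norm_conv_ge_iff[OF A(1) B(1) A(2) B(2) \<kappa>(1)] k_def L_def by blast
  obtain A' where A': "A' \<subseteq> A" "sqrt k / 3 * card A \<le> card A'"
    "k\<^sup>2 * card (difference_set G A') \<le> 2048 * card A'"
    using structured_subset_of_incidences[OF A(1) B(1) S(1) A(2) B(2) S(2,3) k S(4)] by blast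
  show "\<exists>A'\<subseteq>A. 1 / 21 * ln (2 / \<kappa>) powr - (1 / 2) * \<kappa> powr (2 / 3) * real (card A) \<le> real (card A') \<and>
      real (card (difference_set G A')) \<le> 2048 * 48\<^sup>2 * ln (2 / \<kappa>) powr 2 * \<kappa> powr - 2 * real (card A')"
    unfolding L_def[symmetric]
  proof (intro exI conjI)
    show "A' \<subseteq> A" by fact
    have "\<kappa> powr (2/3) \<le> \<kappa> powr (1/2)" using \<kappa> by (intro powr_mono') auto
    then have k23: "\<kappa> powr (2/3) \<le> sqrt \<kappa>" using \<kappa> by (simp add: powr_half_sqrt)
    have "sqrt 48 \<le> 7" by (rule real_le_lsqrt) auto
    have Lh: "L powr - (1/2) = 1 / sqrt L" using L by (simp add: powr_minus powr_half_sqrt divide_simps)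
    have "1 / 21 * L powr - (1/2) * \<kappa> powr (2/3) \<le> 1 / 21 * (1 / sqrt L) * sqrt \<kappa>"
      unfolding Lh using k23 L by (intro mult_left_mono) auto
    also have "\<dots> = sqrt \<kappa> / (7 * sqrt L) / 3" by simp
    also have "\<dots> \<le> sqrt \<kappa> / (sqrt 48 * sqrt L) / 3"
      using \<open>sqrt 48 \<le> 7\<close> L \<kappa> by (intro divide_right_mono divide_left_mono mult_right_mono) auto
    also have "\<dots> = sqrt k / 3" by (simp add: k_def real_sqrt_divide real_sqrt_mult)
    finally have "1 / 21 * L powr - (1/2) * \<kappa> powr (2/3) * card A \<le> sqrt k / 3 * card A"
      by (intro mult_right_mono) auto
    with A'(2) show "1 / 21 * L powr - (1/2) * \<kappa> powr (2/3) * real (card A) \<le> real (card A')" by linarith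
    have "real (card (difference_set G A')) \<le> 2048 * card A' / k\<^sup>2"
      using A'(3) k by (simp add: pos_le_divide_eq mult.commute)
    also have "\<dots> = 2048 * 48\<^sup>2 * L\<^sup>2 * (1 / \<kappa>\<^sup>2) * real (card A')"
      using L \<kappa> by (simp add: k_def power_divide power_mult_distrib)
    also have "\<dots> = 2048 * 48\<^sup>2 * L powr 2 * \<kappa> powr - 2 * real (card A')"
      using L \<kappa> by (simp add: powr_minus_divide)
    finally show "real (card (difference_set G A'))
        \<le> 2048 * 48\<^sup>2 * L powr 2 * \<kappa> powr - 2 * real (card A')" .
  qed
qed

end

subsection \<open>Absoluteness of the constants\<close>

text \<open>Every generated element is a product of a finite word in \<open>H\<close> and its
  inverses, and there are countably many such words.\<close>

lemma (in group) countable_generate: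
  assumes "countable H" "H \<subseteq> carrier G"
  shows "countable (generate G H)"
proof -
  define W where "W = (\<lambda>ws. foldr (mult G) ws \<one>) ` lists (H \<union> m_inv G ` H)"
  have W_carr: "foldr (mult G) ws \<one> \<in> carrier G" if "ws \<in> lists (H \<union> m_inv G ` H)" for ws
    using that assms(2) by (induction ws) auto
  have append: "foldr (mult G) (vs @ ws) \<one> = foldr (mult G) vs \<one> \<otimes> foldr (mult G) ws \<one>"
    if "vs \<in> lists (H \<union> m_inv G ` H)" "ws \<in> lists (H \<union> m_inv G ` H)" for vs ws
    using that(1)
  proof (induction vs)
    case Nil
    then show ?case using W_carr[OF that(2)] by simp
  next
    case (Cons v vs)
    then have "v \<in> carrier G" using assms(2) by auto
    with Cons show ?case using W_carr that(2) by (simp add: m_assoc)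
  qed
  have "generate G H \<subseteq> W"
  proof
    fix x assume "x \<in> generate G H"
    then show "x \<in> W"
    proof induction
      case one
      show ?case unfolding W_def by (rule image_eqI[of _ _ "[]"]) auto
    next
      case (incl h)
      then show ?case unfolding W_def using assms(2) by (intro image_eqI[of _ _ "[h]"]) auto
    next
      case (inv h)
      then show ?case unfolding W_def using assms(2) by (intro image_eqI[of _ _ "[inv h]"]) auto
    next
      case (eng h1 h2)
      then obtain vs ws where "vs \<in> lists (H \<union> m_inv G ` H)" "ws \<in> lists (H \<union> m_inv G ` H)"
        "h1 = foldr (mult G) vs \<one>" "h2 = foldr (mult G) ws \<one>" unfolding W_def by blast
      then show ?case unfolding W_def using append by (intro image_eqI[of _ _ "vs @ ws"]) auto
    qed
  qed
  moreover have "countable W" unfolding W_def using assms(1) by (intro countable_image countable_lists) auto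
  ultimately show ?thesis by (rule countable_subset)
qed

section \<open>Transport along injective homomorphisms\<close>

lemma incidences_image:
  assumes \<phi>: "\<phi> \<in> hom G K" "inj_on \<phi> (carrier G)"
    and closed: "A \<subseteq> carrier G" "B \<subseteq> carrier G" "S \<subseteq> carrier G" "monoid G"
  shows "incidences K (\<phi> ` A) (\<phi> ` B) (\<phi> ` S) = incidences G A B S"
  unfolding incidences_def
proof (rule bij_betw_same_card[symmetric], rule bij_betw_imageI[where f = "map_prod \<phi> \<phi>"])
  have "inj_on (map_prod \<phi> \<phi>) (carrier G \<times> carrier G)"
    by (rule map_prod_inj_on) (rule \<phi>)+
  then show "inj_on (map_prod \<phi> \<phi>) {(a, b). a \<in> A \<and> b \<in> B \<and> a \<otimes>\<^bsub>G\<^esub> b \<in> S}"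
    by (rule inj_on_subset) (use closed in auto)
  have iff: "\<phi> a \<otimes>\<^bsub>K\<^esub> \<phi> b \<in> \<phi> ` S \<longleftrightarrow> a \<otimes>\<^bsub>G\<^esub> b \<in> S" if "a \<in> A" "b \<in> B" for a b
  proof -
    have "a \<in> carrier G" "b \<in> carrier G" using that closed by auto
    then show ?thesis
      using inj_on_image_mem_iff[OF \<phi>(2) monoid.m_closed[OF closed(4)] closed(3)] hom_mult[OF \<phi>(1)]
      by metis
  qed
  show "map_prod \<phi> \<phi> ` {(a, b). a \<in> A \<and> b \<in> B \<and> a \<otimes>\<^bsub>G\<^esub> b \<in> S}
      = {(a, b). a \<in> \<phi> ` A \<and> b \<in> \<phi> ` B \<and> a \<otimes>\<^bsub>K\<^esub> b \<in> \<phi> ` S}"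
  proof (intro subset_antisym subsetI)
    fix p assume "p \<in> map_prod \<phi> \<phi> ` {(a, b). a \<in> A \<and> b \<in> B \<and> a \<otimes>\<^bsub>G\<^esub> b \<in> S}"
    then obtain a b where "a \<in> A" "b \<in> B" "a \<otimes>\<^bsub>G\<^esub> b \<in> S" "p = (\<phi> a, \<phi> b)" by auto
    then show "p \<in> {(a, b). a \<in> \<phi> ` A \<and> b \<in> \<phi> ` B \<and> a \<otimes>\<^bsub>K\<^esub> b \<in> \<phi> ` S}"
      using iff by blast
  next
    fix p assume "p \<in> {(a, b). a \<in> \<phi> ` A \<and> b \<in> \<phi> ` B \<and> a \<otimes>\<^bsub>K\<^esub> b \<in> \<phi> ` S}"
    then obtain a b where p: "a \<in> A" "b \<in> B" "p = (\<phi> a, \<phi> b)" "\<phi> a \<otimes>\<^bsub>K\<^esub> \<phi> b \<in> \<phi> ` S" by auto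
    then have "a \<otimes>\<^bsub>G\<^esub> b \<in> S" using iff by blast
    then show "p \<in> map_prod \<phi> \<phi> ` {(a, b). a \<in> A \<and> b \<in> B \<and> a \<otimes>\<^bsub>G\<^esub> b \<in> S}"
      using p by (intro image_eqI[of _ _ "(a, b)"]) auto
  qed
qed

text \<open>The homomorphism need not be onto, but both inequalities reduce to sums of cubed
  incidences over product sets, which correspond under \<open>\<phi>\<close> term by term.\<close>

lemma l3_norm_conv_image:
  assumes "comm_group G" "comm_group K" and \<phi>: "\<phi> \<in> hom G K" "inj_on \<phi> (carrier G)"
    and AB: "A \<subseteq> carrier G" "B \<subseteq> carrier G" "finite A" "finite B" and "0 < \<kappa>"
  shows "\<kappa> powr (1/3) * real (card (\<phi> ` A)) powr (2/3) * real (card (\<phi> ` B)) powr (2/3)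
      \<le> l3_norm K (conv K (indicator (\<phi> ` A)) (indicator (\<phi> ` B)))
    \<longleftrightarrow> \<kappa> powr (1/3) * real (card A) powr (2/3) * real (card B) powr (2/3)
      \<le> l3_norm G (conv G (indicator A) (indicator B))"
proof -
  interpret G: comm_group G by fact
  have sub: "\<phi> ` A \<subseteq> carrier K" "\<phi> ` B \<subseteq> carrier K"
    using AB hom_in_carrier[OF \<phi>(1)] by auto
  have fin: "finite (\<phi> ` A)" "finite (\<phi> ` B)" using AB by auto
  have card: "card (\<phi> ` A) = card A" "card (\<phi> ` B) = card B"
    using AB \<phi>(2) by (auto intro: card_image inj_on_subset)
  have AB_sub: "A <#>\<^bsub>G\<^esub> B \<subseteq> carrier G" using AB by (intro G.set_mult_closed)
  have "\<phi> ` A <#>\<^bsub>K\<^esub> \<phi> ` B = \<phi> ` (A <#>\<^bsub>G\<^esub> B)"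
    unfolding set_mult_def image_UN using hom_mult[OF \<phi>(1)] AB by (fastforce simp: subset_iff)
  then have "(\<Sum>x\<in>\<phi> ` A <#>\<^bsub>K\<^esub> \<phi> ` B. real (incidences K (\<phi> ` A) (\<phi> ` B) {x}) ^ 3)
      = (\<Sum>x\<in>A <#>\<^bsub>G\<^esub> B. real (incidences K (\<phi> ` A) (\<phi> ` B) (\<phi> ` {x})) ^ 3)"
    using sum.reindex[OF inj_on_subset[OF \<phi>(2) AB_sub]] by simp
  also have "\<dots> = (\<Sum>x\<in>A <#>\<^bsub>G\<^esub> B. real (incidences G A B {x}) ^ 3)"
    using AB_sub by (intro sum.cong refl) (subst incidences_image[OF \<phi> AB(1,2)], auto intro: G.monoid_axioms)
  finally show ?thesis
    unfolding l3_norm_conv_ge_iff[OF assms(1) AB \<open>0 < \<kappa>\<close>]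
      l3_norm_conv_ge_iff[OF assms(2) sub fin \<open>0 < \<kappa>\<close>] by (simp add: card)
qed

lemma difference_set_image:
  assumes "group G" "group K" "\<phi> \<in> hom G K" "A \<subseteq> carrier G"
  shows "difference_set K (\<phi> ` A) = \<phi> ` difference_set G A"
proof -
  interpret group_hom G K \<phi> using assms by (simp add: group_hom_def group_hom_axioms_def)
  have "\<phi> a \<otimes>\<^bsub>K\<^esub> inv\<^bsub>K\<^esub> \<phi> b = \<phi> (a \<otimes>\<^bsub>G\<^esub> inv\<^bsub>G\<^esub> b)" if "a \<in> A" "b \<in> A" for a b
  proof -
    have "a \<in> carrier G" "b \<in> carrier G" using that assms(4) by auto
    then show ?thesis by simp
  qed
  then show ?thesis unfolding difference_set_def by (auto simp: image_iff) metis+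
qed

text \<open>The bound is applied to the images of \<open>A\<close> and \<open>B\<close>. The subset
  it returns is the image of some \<open>A' \<subseteq> A\<close>, and injectivity preserves the
  sizes of \<open>A\<close>, \<open>A'\<close> and the difference set.\<close>

lemma structured_subset_bound_of_inj_hom:
  assumes "comm_group G" "comm_group K" and \<phi>: "\<phi> \<in> hom G K" "inj_on \<phi> (carrier G)"
    and bound: "structured_subset_bound K c1 c2 C1 C2"
  shows "structured_subset_bound G c1 c2 C1 C2"
  unfolding structured_subset_bound_def
proof (intro allI impI, elim conjE exE)
  fix A :: "'a set" and \<kappa> :: real and B
  assume A: "A \<subseteq> carrier G" "finite A" "A \<noteq> {}" and \<kappa>: "0 < \<kappa>" "\<kappa> \<le> 1"
    and B: "B \<subseteq> carrier G" "finite B" "B \<noteq> {}"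
    and L3: "\<kappa> powr (1/3) * real (card A) powr (2/3) * real (card B) powr (2/3)
           \<le> l3_norm G (conv G (indicator A) (indicator B))"
  interpret G: comm_group G by fact
  interpret K: comm_group K by fact
  have "\<exists>D\<subseteq>\<phi> ` A. c1 * ln (2 / \<kappa>) powr - c2 * \<kappa> powr (2 / 3) * real (card (\<phi> ` A)) \<le> real (card D) \<and>
      real (card (difference_set K D)) \<le> C1 * ln (2 / \<kappa>) powr C2 * \<kappa> powr - 2 * real (card D)"
  proof (rule bound[unfolded structured_subset_bound_def, rule_format], intro conjI)
    show "\<exists>D\<subseteq>carrier K. finite D \<and> D \<noteq> {} \<and>
        \<kappa> powr (1 / 3) * real (card (\<phi> ` A)) powr (2 / 3) * real (card D) powr (2 / 3)
        \<le> l3_norm K (conv K (indicator (\<phi> ` A)) (indicator D))"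
      using L3 l3_norm_conv_image[OF assms(1,2) \<phi> A(1) B(1) A(2) B(2) \<kappa>(1)] B hom_in_carrier[OF \<phi>(1)]
      by (intro exI[of _ "\<phi> ` B"]) auto
  qed (use A \<kappa> hom_in_carrier[OF \<phi>(1)] in auto)
  then obtain A' where A': "A' \<subseteq> A"
    and bounds: "c1 * ln (2 / \<kappa>) powr - c2 * \<kappa> powr (2 / 3) * real (card (\<phi> ` A)) \<le> real (card (\<phi> ` A'))"
      "real (card (difference_set K (\<phi> ` A'))) \<le> C1 * ln (2 / \<kappa>) powr C2 * \<kappa> powr - 2 * real (card (\<phi> ` A'))"
    by (auto simp: subset_image_iff)
  have A'_carr: "A' \<subseteq> carrier G" using A' A by auto
  have "difference_set G A' \<subseteq> carrier G" unfolding difference_set_def using A'_carr by auto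
  then have "card (difference_set K (\<phi> ` A')) = card (difference_set G A')"
    using difference_set_image[OF G.is_group K.is_group \<phi>(1) A'_carr] \<phi>(2)
    by (metis card_image inj_on_subset)
  moreover have "card (\<phi> ` A) = card A" "card (\<phi> ` A') = card A'"
    using A A'_carr \<phi>(2) by (auto intro: card_image inj_on_subset)
  ultimately show "\<exists>A'\<subseteq>A. c1 * ln (2 / \<kappa>) powr - c2 * \<kappa> powr (2 / 3) * real (card A) \<le> real (card A') \<and>
      real (card (difference_set G A')) \<le> C1 * ln (2 / \<kappa>) powr C2 * \<kappa> powr - 2 * real (card A')"
    using bounds A' by auto
qed

text \<open>An enumeration of the carrier moves the group structure to a set of natural numbers,
  where the assumption applies, and is itself an injective homomorphism.\<close>

lemma structured_subset_bound_countable: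
  fixes G :: "'a monoid"
  assumes "comm_group G" "countable (carrier G)"
    and nat: "\<forall>K :: nat monoid. comm_group K \<longrightarrow> structured_subset_bound K c1 c2 C1 C2"
  shows "structured_subset_bound G c1 c2 C1 C2"
proof -
  interpret comm_group G by fact
  let ?\<phi> = "to_nat_on (carrier G)"
  have inj: "inj_on ?\<phi> (carrier G)" using assms(2) by (rule inj_on_to_nat_on)
  have iso: "?\<phi> \<in> iso G (image_group ?\<phi> G)" by (rule inj_imp_image_group_iso[OF inj])
  have "comm_group (image_group ?\<phi> G)"
    using iso_imp_img_comm_group[OF iso] by (simp add: image_group_def)
  then show ?thesis
    using structured_subset_bound_of_inj_hom[OF assms(1) _ _ inj] iso nat by (auto simp: iso_def)
qed

text \<open>The explicit bound at type \<open>nat\<close> is a witness for the choice, so the chosen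
  numbers have the defining property, though their values stay unknown.\<close>

lemma absolute_constants_spec:
  assumes "absolute_constants = (c1, c2, C1, C2)"
  shows "0 < c1 \<and> 0 < c2 \<and> 0 < C1 \<and> 0 < C2 \<and>
    (\<forall>K :: nat monoid. comm_group K \<longrightarrow> structured_subset_bound K c1 c2 C1 C2)"
proof -
  let ?P = "\<lambda>(c1, c2, C1, C2). 0 < c1 \<and> 0 < c2 \<and> 0 < C1 \<and> 0 < C2 \<and>
    (\<forall>K :: nat monoid. comm_group K \<longrightarrow> structured_subset_bound K c1 c2 C1 C2)"
  have "?P (1/21, 1/2, 2048 * 48\<^sup>2, 2)" using structured_subset_bound_explicit by auto
  then have "?P absolute_constants" unfolding absolute_constants_def by (rule someI)
  then show ?thesis unfolding assms by simp
qed

theorem theorem3p11: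
  "\<exists>c1 c2 C1 C2 :: real.
     absolute_constants = (c1, c2, C1, C2) \<and>
     0 < c1 \<and> 0 < c2 \<and> 0 < C1 \<and> 0 < C2 \<and>
     (\<forall>(G :: 'a monoid) (A :: 'a set) (\<kappa> :: real).
        comm_group G \<and> A \<subseteq> carrier G \<and> finite A \<and> A \<noteq> {} \<and> 0 < \<kappa> \<and> \<kappa> \<le> 1 \<and>
        (\<exists>B. B \<subseteq> carrier G \<and> finite B \<and> B \<noteq> {} \<and>
           l3_norm G (conv G (indicator A) (indicator B))
             \<ge> \<kappa> powr (1/3) * real (card A) powr (2/3) * real (card B) powr (2/3))
        \<longrightarrow> (\<exists>A'. A' \<subseteq> A \<and>
               real (card A') \<ge> c1 * ln (2 / \<kappa>) powr (- c2) * \<kappa> powr (2/3) * real (card A) \<and>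
               real (card (difference_set G A'))
                 \<le> C1 * ln (2 / \<kappa>) powr C2 * \<kappa> powr (-2) * real (card A')))"
proof -
  obtain c1 c2 C1 C2 where c: "absolute_constants = (c1, c2, C1, C2)" by (cases absolute_constants)
  note spec = absolute_constants_spec[OF c]
  show ?thesis
  proof (rule exI[of _ c1], rule exI[of _ c2], rule exI[of _ C1], rule exI[of _ C2], intro conjI allI impI)
    fix G :: "'a monoid" and A :: "'a set" and \<kappa> :: real
    assume h: "comm_group G \<and> A \<subseteq> carrier G \<and> finite A \<and> A \<noteq> {} \<and> 0 < \<kappa> \<and> \<kappa> \<le> 1 \<and>
        (\<exists>B. B \<subseteq> carrier G \<and> finite B \<and> B \<noteq> {} \<and>
           l3_norm G (conv G (indicator A) (indicator B))
             \<ge> \<kappa> powr (1/3) * real (card A) powr (2/3) * real (card B) powr (2/3))"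
    then interpret comm_group G by simp
    from h obtain B where B: "B \<subseteq> carrier G" "finite B" "B \<noteq> {}"
      "\<kappa> powr (1/3) * real (card A) powr (2/3) * real (card B) powr (2/3)
        \<le> l3_norm G (conv G (indicator A) (indicator B))" by blast
    \<comment> \<open>The explicit bound holds in \<open>G\<close> too, but for its own constants.
      The chosen ones are known to work only for groups on the naturals, hence for countable groups,
      so the argument passes to the subgroup generated by \<open>A\<close> and
      \<open>B\<close>.\<close>
    define K where "K = subgroup_generated G (A \<union> B)"
    have AB: "A \<union> B \<subseteq> carrier G" using h B by auto
    have K: "comm_group K"
      unfolding K_def by (rule abelian_subgroup_generated[OF comm_group_axioms])
    have carr: "carrier K = generate G (A \<union> B)"
      unfolding K_def carrier_subgroup_generated using AB by (simp add: Int_absorb1)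
    have AB_K: "A \<subseteq> carrier K" "B \<subseteq> carrier K" unfolding carr by (auto intro: generate.incl)
    have K_sub: "carrier K \<subseteq> carrier G" unfolding carr by (rule generate_incl[OF AB])
    have "countable (carrier K)"
      unfolding carr using h B countable_generate[OF _ AB] by (simp add: countable_finite)
    then have bound: "structured_subset_bound K c1 c2 C1 C2"
      using structured_subset_bound_countable[OF K] spec by blast
    \<comment> \<open>The inclusion of \<open>K\<close> is an injective homomorphism, so the norm
      condition and the difference sets mean the same in \<open>K\<close> and in
      \<open>G\<close>.\<close>
    have hom: "id \<in> hom K G" using K_sub by (auto simp: hom_def K_def)
    have "\<kappa> powr (1/3) * real (card A) powr (2/3) * real (card B) powr (2/3)
        \<le> l3_norm K (conv K (indicator A) (indicator B))"
      using l3_norm_conv_image[OF K comm_group_axioms hom, of A B \<kappa>] AB_K h B by simp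
    then have "\<exists>A'\<subseteq>A. c1 * ln (2 / \<kappa>) powr - c2 * \<kappa> powr (2 / 3) * real (card A) \<le> real (card A') \<and>
      real (card (difference_set K A')) \<le> C1 * ln (2 / \<kappa>) powr C2 * \<kappa> powr - 2 * real (card A')"
      using bound[unfolded structured_subset_bound_def, rule_format, of A \<kappa>] AB_K h B
      by blast
    moreover have "difference_set K A' = difference_set G A'" if "A' \<subseteq> A" for A'
      using difference_set_image[OF _ is_group hom, of A'] that AB_K K
      by (auto simp: comm_group_def)
    ultimately show "\<exists>A'. A' \<subseteq> A \<and>
               real (card A') \<ge> c1 * ln (2 / \<kappa>) powr (- c2) * \<kappa> powr (2/3) * real (card A) \<and>
               real (card (difference_set G A'))
                 \<le> C1 * ln (2 / \<kappa>) powr C2 * \<kappa> powr (-2) * real (card A')"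
      by metis
  qed (use c spec in auto)
qed

end
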